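(* Let $G_1$ be an $r$-regular connected integral graph with $n_1$ vertices, and let $G_2$ be a $k$-regular graph with $n_2$ vertices. If $\sqrt{(r-k)^2+4n_2r^2}$ is not an integer, then for every $v\in V(G_1)$ and every $w\in V(G_2)\cup\{0\}$ the vertex $(v,w)$ is not periodic in $G_1\bigstar G_2$. Moreover, $G_1\bigstar G_2$ admits no perfect state transfer (between any two vertices).
   Context: All graphs are finite, simple and undirected. A graph is integral if all eigenvalues of its adjacency matrix are integers. For graphs $G_1$ (order $n_1$) and $G_2$ (order $n_2$), the neighborhood corona $G_1\bigstar G_2$ is obtained from one copy of $G_1$ and $n_1$ copies of $G_2$ by joining every neighbor (in $G_1$) of the $i$-th vertex of $G_1$ to every vertex of the $i$-th copy of $G_2$. Its vertex set is $V(G_1)\times(\{0\}\cup V(G_2))$, where $(x,0)$ is vertex $x$ of $G_1$ and $(x,y)$ is vertex $y$ of the copy attached to $x$. For a graph $G$ with adjacency matrix $A(G)$ let $U(t)=\exp(-itA(G))$. A vertex $u$ is periodic if $|e_u^TU(t)e_u|=1$ for some $t>0$. $G$ admits perfect state transfer between distinct vertices $x,y$ if $U(t)e_x=\gamma e_y$ for some $t>0$ and some $\gamma\in\mathbb{C}$ with $|\gamma|=1$. *)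

theory Defs
  imports "HOL-Analysis.Analysis"
begin

text \<open>
  A graph is given by its adjacency relation on a finite vertex type, and vectors and matrices
  are indexed by the vertices themselves.
\<close>

definition simple_graph :: "('a \<Rightarrow> 'a \<Rightarrow> bool) \<Rightarrow> bool" where
  "simple_graph G \<longleftrightarrow> symp G \<and> irreflp G"

definition connected_graph :: "('a \<Rightarrow> 'a \<Rightarrow> bool) \<Rightarrow> bool" where
  "connected_graph G \<longleftrightarrow> (\<forall>x y. G\<^sup>*\<^sup>* x y)"

definition regular_graph :: "nat \<Rightarrow> ('a \<Rightarrow> 'a \<Rightarrow> bool) \<Rightarrow> bool" where
  "regular_graph d G \<longleftrightarrow> (\<forall>x. card {y. G x y} = d)"

definition adj_matrix :: "('a::finite \<Rightarrow> 'a \<Rightarrow> bool) \<Rightarrow> complex ^ 'a ^ 'a" where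
  "adj_matrix G = (\<chi> x y. if G x y then 1 else 0)"

definition eigenvalue :: "complex ^ 'n ^ 'n \<Rightarrow> complex \<Rightarrow> bool" where
  "eigenvalue A \<theta> \<longleftrightarrow> (\<exists>v. v \<noteq> 0 \<and> A *v v = \<theta> *s v)"

definition integral_graph :: "('a::finite \<Rightarrow> 'a \<Rightarrow> bool) \<Rightarrow> bool" where
  "integral_graph G \<longleftrightarrow> (\<forall>\<theta>. eigenvalue (adj_matrix G) \<theta> \<longrightarrow> \<theta> \<in> \<int>)"

text \<open>
  The vertex \<open>(x, None)\<close> of the neighborhood corona is the vertex \<open>(x, 0)\<close>, that is, the vertex
  \<open>x\<close> of \<open>G\<close>; the vertex \<open>(x, Some y)\<close> is the vertex \<open>y\<close> of the copy of \<open>H\<close> attached to \<open>x\<close>.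
\<close>

fun neighborhood_corona ::
  "('a \<Rightarrow> 'a \<Rightarrow> bool) \<Rightarrow> ('b \<Rightarrow> 'b \<Rightarrow> bool) \<Rightarrow> 'a \<times> 'b option \<Rightarrow> 'a \<times> 'b option \<Rightarrow> bool" where
  "neighborhood_corona G H (x, None) (x', None) \<longleftrightarrow> G x x'"
| "neighborhood_corona G H (x, None) (x', Some y') \<longleftrightarrow> G x' x"
| "neighborhood_corona G H (x, Some y) (x', None) \<longleftrightarrow> G x x'"
| "neighborhood_corona G H (x, Some y) (x', Some y') \<longleftrightarrow> x = x' \<and> H y y'"

lemma simple_graph_neighborhood_corona:
  assumes "simple_graph G" "simple_graph H"
  shows "simple_graph (neighborhood_corona G H)"
  unfolding simple_graph_def
proof
  have G: "G x y \<longleftrightarrow> G y x" "\<not> G x x" for x y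
    using assms(1) by (auto simp: simple_graph_def dest: sympD irreflpD)
  have H: "H x y \<longleftrightarrow> H y x" "\<not> H x x" for x y
    using assms(2) by (auto simp: simple_graph_def dest: sympD irreflpD)
  show "symp (neighborhood_corona G H)"
  proof (rule sympI)
    fix p q assume "neighborhood_corona G H p q"
    then show "neighborhood_corona G H q p"
      by (cases "(G, H, p, q)" rule: neighborhood_corona.cases) (auto simp: G(1) H(1))
  qed
  show "irreflp (neighborhood_corona G H)"
  proof (rule irreflpI)
    fix p show "\<not> neighborhood_corona G H p p"
      by (cases "(G, H, p, p)" rule: neighborhood_corona.cases) (auto simp: G(2) H(2))
  qed
qed

text \<open>
  On this matrix type \<open>*\<close> and \<open>^\<close> act componentwise, so powers with respect to \<open>**\<close> and the
  exponential series are written out.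
\<close>

definition matrix_power :: "complex ^ 'n ^ 'n \<Rightarrow> nat \<Rightarrow> complex ^ 'n ^ 'n" where
  "matrix_power A k = ((**) A ^^ k) (mat 1)"

definition matrix_exp :: "complex ^ 'n ^ 'n \<Rightarrow> complex ^ 'n ^ 'n" where
  "matrix_exp A = (\<Sum>k. matrix_power A k /\<^sub>R fact k)"

lemma summable_matrix_exp:
  fixes A :: "complex ^ 'n ^ 'n"
  shows "summable (\<lambda>k. matrix_power A k /\<^sub>R fact k)"
proof -
  define c where "c = (\<Sum>i\<in>UNIV. \<Sum>j\<in>UNIV. norm (A $ i $ j))"
  have row: "(\<Sum>l\<in>UNIV. norm (A $ i $ l)) \<le> c" for i
    unfolding c_def
    by (rule member_le_sum[of i UNIV "\<lambda>i. \<Sum>l\<in>UNIV. norm (A $ i $ l)"]) (auto intro: sum_nonneg)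
  have c0: "c \<ge> 0" unfolding c_def by (intro sum_nonneg) auto
  have entry: "norm (matrix_power A k $ i $ j) \<le> c ^ k" for k i j
  proof (induction k arbitrary: i j)
    case 0
    then show ?case by (simp add: matrix_power_def mat_def)
  next
    case (Suc k)
    have "norm (matrix_power A (Suc k) $ i $ j) =
        norm (\<Sum>l\<in>UNIV. A $ i $ l * matrix_power A k $ l $ j)"
      by (simp add: matrix_power_def matrix_matrix_mult_def)
    also have "\<dots> \<le> (\<Sum>l\<in>UNIV. norm (A $ i $ l) * c ^ k)"
      by (rule sum_norm_le) (auto simp: norm_mult intro!: mult_left_mono Suc.IH)
    also have "\<dots> \<le> c * c ^ k"
      unfolding sum_distrib_right[symmetric] by (rule mult_right_mono[OF row]) (simp add: c0)
    finally show ?case by simp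
  qed
  define M where "M = real CARD('n) * real CARD('n)"
  have bound: "norm (matrix_power A k) \<le> M * c ^ k" for k
  proof -
    have "norm (matrix_power A k) \<le> (\<Sum>i\<in>UNIV. norm (matrix_power A k $ i))"
      unfolding norm_vec_def by (rule L2_set_le_sum) simp
    also have "\<dots> \<le> (\<Sum>i\<in>UNIV. \<Sum>j\<in>UNIV. norm (matrix_power A k $ i $ j))"
    proof (rule sum_mono)
      fix i
      show "norm (matrix_power A k $ i) \<le> (\<Sum>j\<in>UNIV. norm (matrix_power A k $ i $ j))"
        unfolding norm_vec_def[of "matrix_power A k $ i"] by (rule L2_set_le_sum) simp
    qed
    also have "\<dots> \<le> (\<Sum>i\<in>(UNIV::'n set). \<Sum>j\<in>(UNIV::'n set). c ^ k)"
      by (intro sum_mono entry)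
    also have "\<dots> = M * c ^ k" by (simp add: M_def)
    finally show ?thesis .
  qed
  show ?thesis
  proof (rule summable_comparison_test')
    show "summable (\<lambda>k. M * (c ^ k /\<^sub>R fact k))"
      by (intro summable_mult summable_exp_generic)
    show "norm (matrix_power A k /\<^sub>R fact k) \<le> M * (c ^ k /\<^sub>R fact k)" if "k \<ge> 0" for k
      using mult_left_mono[OF bound[of k], of "inverse (fact k)"] by (simp add: mult_ac)
  qed
qed

definition transition_matrix :: "('a::finite \<Rightarrow> 'a \<Rightarrow> bool) \<Rightarrow> real \<Rightarrow> complex ^ 'a ^ 'a" where
  "transition_matrix G t = matrix_exp (\<chi> x y. - \<i> * of_real t * adj_matrix G $ x $ y)"

text \<open>The basis vector \<open>e\<^sub>u\<close> is \<open>axis u 1\<close>, and \<open>z $ u\<close> is \<open>e\<^sub>u\<^sup>T z\<close>.\<close>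

definition periodic_vertex :: "('a::finite \<Rightarrow> 'a \<Rightarrow> bool) \<Rightarrow> 'a \<Rightarrow> bool" where
  "periodic_vertex G u \<longleftrightarrow> (\<exists>t>0. cmod ((transition_matrix G t *v axis u 1) $ u) = 1)"

definition perfect_state_transfer :: "('a::finite \<Rightarrow> 'a \<Rightarrow> bool) \<Rightarrow> 'a \<Rightarrow> 'a \<Rightarrow> bool" where
  "perfect_state_transfer G x y \<longleftrightarrow> x \<noteq> y \<and>
     (\<exists>t>0. \<exists>\<gamma>. cmod \<gamma> = 1 \<and> transition_matrix G t *v axis x 1 = \<gamma> *s axis y 1)"

end

theory Submission
  imports Defs
begin

text \<open>
  Since \<open>U(t)\<close> is unitary and symmetric, periodicity at \<open>p\<close>, or perfect state transfer from \<open>p\<close>,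
  makes \<open>exp (-i s \<mu>)\<close> take one and the same value, for some \<open>s > 0\<close>, at all eigenvalues \<open>\<mu>\<close> that
  have a real eigenvector not vanishing at \<open>p\<close>. An eigenvalue \<open>\<theta> \<noteq> 0\<close> of \<open>G\<^sub>1\<close> in the support of
  \<open>v\<close> contributes the two eigenvalues \<open>(\<theta> + k \<plusminus> \<surd>((\<theta> - k)\<^sup>2 + 4n\<^sub>2\<theta>\<^sup>2))/2\<close> of the corona to the
  support of every \<open>(v, w)\<close>. The diagonal entry \<open>A(G\<^sub>1)\<^sub>v\<^sub>v = 0\<close> forces some \<open>\<theta> < 0\<close> into the support of
  \<open>v\<close>, next to \<open>\<theta> = r\<close>. Both the difference \<open>\<surd>((r - k)\<^sup>2 + 4n\<^sub>2r\<^sup>2)\<close> of the two eigenvalues over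
  \<open>r\<close> and the integer \<open>r - \<theta>\<close>, by which the two pairs differ in sum, are then multiples of
  \<open>2\<pi>/s\<close>, so this square root is rational and hence an integer.
\<close>

section \<open>Matrix exponentials\<close>

lemma matrix_power_0 [simp]: "matrix_power A 0 = mat 1"
  by (simp add: matrix_power_def)

lemma matrix_power_Suc: "matrix_power A (Suc n) = A ** matrix_power A n"
  by (simp add: matrix_power_def)

lemma matrix_power_add: "matrix_power A (m + n) = matrix_power A m ** matrix_power A n"
  by (induction m) (simp_all add: matrix_power_Suc matrix_mul_assoc)

lemma matrix_power_scale:
  "matrix_power (\<chi> i j. c * A $ i $ j) n = (\<chi> i j. c ^ n * matrix_power A n $ i $ j)"
proof (induction n)
  case 0
  show ?case by simp
next
  case (Suc n)
  show ?case
    by (simp add: matrix_power_Suc Suc.IH matrix_matrix_mult_def sum_distrib_left mult_ac)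
qed

lemma transpose_matrix_power: "transpose (matrix_power A n) = matrix_power (transpose A) n"
proof (induction n)
  case 0
  show ?case by (simp add: transpose_mat)
next
  case (Suc n)
  \<comment> \<open>Transposition leaves the extra factor on the right; since powers of one matrix
    commute, additivity of exponents brings it to the left.\<close>
  have "transpose (matrix_power A (Suc n)) = matrix_power (transpose A) n ** matrix_power (transpose A) 1"
    by (simp add: matrix_power_Suc matrix_transpose_mul Suc.IH)
  then show ?case
    by (simp flip: matrix_power_add)
qed

lemma cnj_matrix_power:
  "cnj (matrix_power A n $ i $ j) = matrix_power (\<chi> i j. cnj (A $ i $ j)) n $ i $ j"
proof (induction n arbitrary: i j)
  case 0
  show ?case by (simp add: mat_def)
next
  case (Suc n)
  show ?case by (simp add: matrix_power_Suc matrix_matrix_mult_def Suc.IH)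
qed

lemma matrix_exp_sums: "(\<lambda>n. matrix_power A n /\<^sub>R fact n) sums matrix_exp A"
  unfolding matrix_exp_def by (rule summable_sums[OF summable_matrix_exp])

lemma matrix_exp_nth_sums:
  "(\<lambda>n. matrix_power A n $ i $ j /\<^sub>R fact n) sums (matrix_exp A $ i $ j)"
  using sums_vec_nth[OF sums_vec_nth[OF matrix_exp_sums[of A], of i], of j] by simp

text \<open>Passing from \<open>A\<close> to \<open>2A\<close> turns plain into absolute convergence of the entries.\<close>

lemma summable_norm_matrix_exp_nth:
  "summable (\<lambda>n. norm (matrix_power A n $ i $ j /\<^sub>R fact n))"
proof -
  have "summable (\<lambda>n. (matrix_power A n $ i $ j /\<^sub>R fact n) * 2 ^ n)"
    using sums_summable[OF matrix_exp_nth_sums[of "\<chi> i j. 2 * A $ i $ j" i j]]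
    by (simp add: matrix_power_scale mult_ac)
  from powser_insidea[OF this, of 1] show ?thesis by simp
qed

lemma transpose_matrix_exp: "transpose (matrix_exp A) = matrix_exp (transpose A)"
proof -
  have "matrix_exp A $ j $ i = matrix_exp (transpose A) $ i $ j" for i j
  proof (rule sums_unique2[OF matrix_exp_nth_sums])
    have "matrix_power A n $ j $ i = matrix_power (transpose A) n $ i $ j" for n
      unfolding transpose_matrix_power[symmetric] by (simp add: transpose_def)
    then show "(\<lambda>n. matrix_power A n $ j $ i /\<^sub>R fact n) sums (matrix_exp (transpose A) $ i $ j)"
      using matrix_exp_nth_sums[of "transpose A" i j] by simp
  qed
  then show ?thesis by (simp add: vec_eq_iff transpose_def)
qed

lemma cnj_matrix_exp: "cnj (matrix_exp A $ i $ j) = matrix_exp (\<chi> i j. cnj (A $ i $ j)) $ i $ j"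
proof (rule sums_unique2)
  show "(\<lambda>n. cnj (matrix_power A n $ i $ j /\<^sub>R fact n)) sums cnj (matrix_exp A $ i $ j)"
    using matrix_exp_nth_sums by (simp only: sums_cnj)
  show "(\<lambda>n. cnj (matrix_power A n $ i $ j /\<^sub>R fact n)) sums
      (matrix_exp (\<chi> i j. cnj (A $ i $ j)) $ i $ j)"
    using matrix_exp_nth_sums[of "\<chi> i j. cnj (A $ i $ j)" i j] by (simp add: cnj_matrix_power)
qed

text \<open>The entries converge absolutely, so the product is a Cauchy product. Its
  \<open>n\<close>-th term is the \<open>n\<close>-th power of \<open>A\<close> times
  \<open>(1 - 1) ^ n / n!\<close> by the binomial theorem, which vanishes for
  \<open>n > 0\<close>.\<close>

lemma matrix_exp_mult_uminus: "matrix_exp A ** matrix_exp (- A) = mat 1"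
proof -
  define P where "P n i j = matrix_power A n $ i $ j" for n i j
  have neg: "matrix_power (- A) n $ i $ j = (- 1) ^ n * P n i j" for n i j
  proof -
    have "- A = (\<chi> i j. (- 1) * A $ i $ j)" by (simp add: vec_eq_iff)
    then show ?thesis by (simp only: matrix_power_scale) (simp add: P_def)
  qed
  \<comment> \<open>The scalar binomial identity is read off from the exponential series at
    \<open>1\<close> and \<open>- 1\<close>. With \<open>0 ^ 0 = 1\<close> it also covers
    \<open>n = 0\<close>, the one surviving term.\<close>
  have binomial: "(\<Sum>m\<le>n. inverse (fact m) *\<^sub>R ((- 1) ^ (n - m) /\<^sub>R fact (n - m))) =
      (0::complex) ^ n /\<^sub>R fact n" for n
    using exp_series_add_commuting[of "1::complex" "- 1" n] by (simp add: mult.commute)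
  have entry: "(matrix_exp A ** matrix_exp (- A)) $ i $ j = (mat 1 :: complex ^ 'a ^ 'a) $ i $ j"
    for i j
  proof (rule sums_unique2)
    have "(\<lambda>n. \<Sum>m\<le>n. (P m i l /\<^sub>R fact m) * (matrix_power (- A) (n - m) $ l $ j /\<^sub>R fact (n - m)))
        sums (matrix_exp A $ i $ l * matrix_exp (- A) $ l $ j)" for l
      using Cauchy_product_sums[OF summable_norm_matrix_exp_nth[of A i l]
          summable_norm_matrix_exp_nth[of "- A" l j]]
      by (simp add: sums_unique[OF matrix_exp_nth_sums, symmetric] P_def)
    then have *: "(\<lambda>n. \<Sum>l\<in>UNIV. \<Sum>m\<le>n. (P m i l /\<^sub>R fact m) *
        (matrix_power (- A) (n - m) $ l $ j /\<^sub>R fact (n - m)))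
        sums (\<Sum>l\<in>UNIV. matrix_exp A $ i $ l * matrix_exp (- A) $ l $ j)"
      by (rule sums_sum)
    have "(\<Sum>l\<in>UNIV. \<Sum>m\<le>n. (P m i l /\<^sub>R fact m) *
        (matrix_power (- A) (n - m) $ l $ j /\<^sub>R fact (n - m))) = (0 ^ n /\<^sub>R fact n) * P n i j" for n
    proof -
      have "(\<Sum>l\<in>UNIV. \<Sum>m\<le>n. (P m i l /\<^sub>R fact m) *
          (matrix_power (- A) (n - m) $ l $ j /\<^sub>R fact (n - m))) =
          (\<Sum>m\<le>n. inverse (fact m) *\<^sub>R ((- 1) ^ (n - m) /\<^sub>R fact (n - m)) *
            (\<Sum>l\<in>UNIV. P m i l * P (n - m) l j))"
        by (subst sum.swap) (simp add: neg sum_distrib_left scaleR_conv_of_real mult_ac)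
      also have "\<dots> = (\<Sum>m\<le>n. inverse (fact m) *\<^sub>R ((- 1) ^ (n - m) /\<^sub>R fact (n - m)) * P n i j)"
      proof (rule sum.cong[OF refl])
        fix m assume "m \<in> {..n}"
        then have "matrix_power A n = matrix_power A m ** matrix_power A (n - m)"
          by (simp flip: matrix_power_add)
        then show "inverse (fact m) *\<^sub>R ((- 1) ^ (n - m) /\<^sub>R fact (n - m)) *
            (\<Sum>l\<in>UNIV. P m i l * P (n - m) l j) =
            inverse (fact m) *\<^sub>R ((- 1) ^ (n - m) /\<^sub>R fact (n - m)) * P n i j"
          by (simp add: P_def matrix_matrix_mult_def)
      qed
      also have "\<dots> = (0 ^ n /\<^sub>R fact n) * P n i j"
        by (simp only: binomial flip: sum_distrib_right)
      finally show ?thesis .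
    qed
    with * show "(\<lambda>n. (0 ^ n /\<^sub>R fact n) * P n i j) sums ((matrix_exp A ** matrix_exp (- A)) $ i $ j)"
      by (simp add: matrix_matrix_mult_def)
    show "(\<lambda>n. (0 ^ n /\<^sub>R fact n) * P n i j) sums ((mat 1 :: complex ^ 'a ^ 'a) $ i $ j)"
    proof -
      have "(\<lambda>n. (0 ^ n /\<^sub>R fact n) * P n i j) sums (\<Sum>n\<in>{0}. (0 ^ n /\<^sub>R fact n) * P n i j)"
        by (rule sums_finite) auto
      then show ?thesis by (simp add: P_def)
    qed
  qed
  then show ?thesis by (simp add: vec_eq_iff)
qed

text \<open>Each power of \<open>A\<close> multiplies \<open>z\<close> by the same power of
  \<open>c\<close>. Left vectors fit the later arguments, which read off a column of the transition
  matrix.\<close>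

lemma matrix_exp_left_eigenvector:
  fixes A :: "complex ^ 'n ^ 'n"
  assumes "z v* A = c *s z"
  shows "z v* matrix_exp A = exp c *s z"
proof -
  have power: "z v* matrix_power A n = c ^ n *s z" for n
  proof (induction n)
    case 0
    show ?case by simp
  next
    case (Suc n)
    have "z v* matrix_power A (Suc n) = (c *s z) v* matrix_power A n"
      by (simp add: matrix_power_Suc assms flip: vector_matrix_mul_assoc)
    also have "\<dots> = c *s (z v* matrix_power A n)"
      by (simp add: vec_eq_iff vector_matrix_mult_def sum_distrib_left mult_ac)
    finally show ?case by (simp add: Suc.IH)
  qed
  have "(z v* matrix_exp A) $ j = exp c * z $ j" for j
  proof (rule sums_unique2)
    show "(\<lambda>n. \<Sum>i\<in>UNIV. z $ i * (matrix_power A n $ i $ j /\<^sub>R fact n)) sums (z v* matrix_exp A) $ j"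
    proof -
      have "(z v* matrix_exp A) $ j = (\<Sum>i\<in>UNIV. z $ i * matrix_exp A $ i $ j)"
        by (simp add: vector_matrix_mult_def mult.commute)
      then show ?thesis
        by (simp only:) (intro sums_sum sums_mult matrix_exp_nth_sums)
    qed
    have "(\<Sum>i\<in>UNIV. z $ i * (matrix_power A n $ i $ j /\<^sub>R fact n)) = c ^ n /\<^sub>R fact n * z $ j" for n
    proof -
      have "(\<Sum>i\<in>UNIV. z $ i * (matrix_power A n $ i $ j /\<^sub>R fact n)) =
          (z v* matrix_power A n) $ j /\<^sub>R fact n"
        by (simp add: vector_matrix_mult_def scaleR_right.sum mult.commute)
      then show ?thesis by (simp add: power)
    qed
    then show "(\<lambda>n. \<Sum>i\<in>UNIV. z $ i * (matrix_power A n $ i $ j /\<^sub>R fact n)) sums (exp c * z $ j)"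
      using sums_mult2[OF exp_converges[of c], of "z $ j"] by simp
  qed
  then show ?thesis by (simp add: vec_eq_iff)
qed

section \<open>Negative eigenvalues of self-adjoint operators\<close>

text \<open>A first variation: moving from \<open>x\<close> in the direction \<open>- f x\<close>
  changes the form at first order by a negative multiple of the squared norm of \<open>f x\<close>,
  so nonnegativity forces \<open>f x = 0\<close>.\<close>

lemma self_adjoint_nonneg_kernel:
  fixes f :: "'e::euclidean_space \<Rightarrow> 'e"
  assumes "linear f" and sa: "\<And>x y. x \<bullet> f y = f x \<bullet> y"
    and W: "subspace W" "\<And>x. x \<in> W \<Longrightarrow> f x \<in> W"
    and nonneg: "\<And>y. y \<in> W \<Longrightarrow> 0 \<le> y \<bullet> f y"
    and x: "x \<in> W" "x \<bullet> f x = 0"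
  shows "f x = 0"
proof -
  define y where "y = f x"
  define a where "a = y \<bullet> y"
  define b where "b = y \<bullet> f y"
  \<comment> \<open>Adding 1 keeps the denominator positive even for \<open>b = 0\<close>; the form
    at \<open>x + s *\<^sub>R y\<close> becomes
    \<open>- a\<^sup>2 * (b + 2) / (b + 1)\<^sup>2\<close>.\<close>
  define s where "s = - a / (b + 1)"
  have y: "y \<in> W" using W(2) x(1) by (simp add: y_def)
  have b: "b \<ge> 0" using nonneg[OF y] by (simp add: b_def)
  have "0 \<le> (x + s *\<^sub>R y) \<bullet> f (x + s *\<^sub>R y)"
    by (intro nonneg subspace_add subspace_scale W(1) x(1) y)
  also have "\<dots> = 2 * s * a + s\<^sup>2 * b"
    using x(2) sa[of x y]
    by (simp add: linear_add[OF \<open>linear f\<close>] linear_scale[OF \<open>linear f\<close>] inner_simps a_def b_def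
        power2_eq_square distrib_left flip: y_def)
  finally have "0 \<le> (b + 1)\<^sup>2 * (2 * s * a + s\<^sup>2 * b)" by simp
  also have "\<dots> = - (a\<^sup>2 * (b + 2))"
  proof -
    have "s * (b + 1) = - a" using b by (simp add: s_def)
    then show ?thesis by algebra
  qed
  finally have "a\<^sup>2 * (b + 2) \<le> 0" by simp
  then have "a = 0"
    using b by (auto simp: mult_le_0_iff)
  then show ?thesis by (simp add: a_def y_def)
qed

text \<open>At a minimiser \<open>u\<close> of the form on the unit sphere of \<open>W\<close>, with
  minimum \<open>m\<close>, the form of \<open>f - m\<close> is nonnegative on \<open>W\<close> and
  vanishes at \<open>u\<close>, so \<open>u\<close> lies in the kernel of
  \<open>f - m\<close>.\<close>

lemma self_adjoint_least_eigenvalue: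
  fixes f :: "'e::euclidean_space \<Rightarrow> 'e"
  assumes "linear f" and sa: "\<And>x y. x \<bullet> f y = f x \<bullet> y"
    and W: "subspace W" "\<And>x. x \<in> W \<Longrightarrow> f x \<in> W" and e: "e \<in> W" "e \<noteq> 0"
  obtains m u where "u \<in> W" "u \<noteq> 0" "f u = m *\<^sub>R u" "\<And>y. y \<in> W \<Longrightarrow> m * (y \<bullet> y) \<le> y \<bullet> f y"
proof -
  let ?S = "sphere 0 1 \<inter> W"
  have "compact ?S"
    by (intro compact_Int_closed closed_subspace W(1)) simp
  moreover have "e /\<^sub>R norm e \<in> ?S"
    using e by (auto intro: subspace_scale W(1))
  moreover have "continuous_on ?S (\<lambda>x. x \<bullet> f x)"
    by (intro continuous_intros linear_continuous_on linear_conv_bounded_linear[THEN iffD1] \<open>linear f\<close>)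
  ultimately obtain u where u: "u \<in> ?S" and min: "\<And>y. y \<in> ?S \<Longrightarrow> u \<bullet> f u \<le> y \<bullet> f y"
    using continuous_attains_inf[of ?S "\<lambda>x. x \<bullet> f x"] by blast
  define m where "m = u \<bullet> f u"
  have bound: "m * (y \<bullet> y) \<le> y \<bullet> f y" if "y \<in> W" for y
  proof (cases "y = 0")
    case False
    have "m \<le> (y /\<^sub>R norm y) \<bullet> f (y /\<^sub>R norm y)"
      unfolding m_def using False that by (intro min) (auto intro: subspace_scale W(1))
    also have "\<dots> = (y \<bullet> f y) / (y \<bullet> y)"
      by (simp add: linear_scale[OF \<open>linear f\<close>] power2_eq_square divide_inverse
          flip: power2_norm_eq_inner)
    finally show ?thesis using False by (simp add: field_simps)
  qed simp
  have uu: "u \<bullet> u = 1" using u by (simp flip: power2_norm_eq_inner)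
  then have "u \<noteq> 0" by auto
  have "f u - m *\<^sub>R u = 0"
  proof (rule self_adjoint_nonneg_kernel[of "\<lambda>x. f x - m *\<^sub>R x" W])
    show "linear (\<lambda>x. f x - m *\<^sub>R x)"
      by (intro linear_compose_sub \<open>linear f\<close> linear_scale_self)
    show "f x - m *\<^sub>R x \<in> W" if "x \<in> W" for x
      using that by (intro subspace_diff subspace_scale W)
  qed (use u bound W(1) in \<open>auto simp: inner_simps sa uu m_def\<close>)
  then show thesis
    using that[OF _ \<open>u \<noteq> 0\<close> _ bound] u by auto
qed

text \<open>For an adjacency operator and a basis vector \<open>e\<close>,
  \<open>e \<bullet> f e = 0\<close> is the zero diagonal entry. Were the least eigenvalue on the
  space \<open>W\<close> below nonnegative, the form would be nonnegative there and force
  \<open>f e = 0\<close>.\<close>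

lemma self_adjoint_negative_eigenvalue:
  fixes f :: "'e::euclidean_space \<Rightarrow> 'e"
  assumes "linear f" and sa: "\<And>x y. x \<bullet> f y = f x \<bullet> y"
    and e: "e \<bullet> f e = 0" "f e \<noteq> 0"
  obtains m u where "m < 0" "f u = m *\<^sub>R u" "u \<bullet> e \<noteq> 0"
proof -
  \<comment> \<open>An eigenvector in \<open>W\<close> that is orthogonal to \<open>e\<close> would
    be orthogonal to itself. So every nonzero eigenvector found inside \<open>W\<close> is in the
    support of \<open>e\<close>, without a spectral decomposition.\<close>
  define W where "W = {x. \<forall>u. u \<bullet> e = 0 \<and> (\<exists>m. f u = m *\<^sub>R u) \<longrightarrow> u \<bullet> x = 0}"
  have W: "subspace W"
    unfolding W_def subspace_def by (auto simp: inner_simps)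
  have fW: "f x \<in> W" if "x \<in> W" for x
    using that unfolding W_def by (auto simp: sa)
  have eW: "e \<in> W" by (simp add: W_def)
  have "e \<noteq> 0" using e(2) linear_0[OF \<open>linear f\<close>] by auto
  obtain m u where u: "u \<in> W" "u \<noteq> 0" "f u = m *\<^sub>R u"
    and min: "\<And>y. y \<in> W \<Longrightarrow> m * (y \<bullet> y) \<le> y \<bullet> f y"
    using self_adjoint_least_eigenvalue[OF \<open>linear f\<close> sa W fW eW \<open>e \<noteq> 0\<close>] by metis
  have "u \<bullet> e \<noteq> 0" using u by (auto simp: W_def)
  moreover have "m < 0"
  proof (rule ccontr)
    assume "\<not> m < 0"
    then have "0 \<le> y \<bullet> f y" if "y \<in> W" for y
      using order_trans[OF mult_nonneg_nonneg min[OF that]] by simp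
    from self_adjoint_nonneg_kernel[OF \<open>linear f\<close> sa W fW this eW e(1)] e(2)
    show False by simp
  qed
  ultimately show thesis using that u(3) by blast
qed

section \<open>Quantum walks\<close>

lemma matrix_vector_mult_axis_nth:
  fixes A :: "'c::semiring_1 ^ 'n ^ 'm"
  shows "(A *v axis j 1) $ i = A $ i $ j"
  by (simp add: matrix_vector_mult_def axis_def if_distrib cong: if_cong)

text \<open>The adjacency matrix acting on real vectors, where the Euclidean inner product and the
  spectral lemmas above are available.\<close>

definition adj_op :: "('v::finite \<Rightarrow> 'v \<Rightarrow> bool) \<Rightarrow> real ^ 'v \<Rightarrow> real ^ 'v" where
  "adj_op G z = (\<chi> x. \<Sum>y | G x y. z $ y)"

lemma linear_adj_op: "linear (adj_op G)"
  by (rule linearI) (simp_all add: adj_op_def vec_eq_iff sum.distrib sum_distrib_left)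

lemma simple_graph_sym: "simple_graph G \<Longrightarrow> G x y \<longleftrightarrow> G y x"
  by (auto simp: simple_graph_def dest: sympD)

lemma adj_op_self_adjoint:
  assumes "simple_graph G"
  shows "x \<bullet> adj_op G y = adj_op G x \<bullet> y"
proof -
  have "x \<bullet> adj_op G y = (\<Sum>i\<in>UNIV. \<Sum>j\<in>UNIV. if G i j then x $ i * y $ j else 0)"
    by (simp add: inner_vec_def adj_op_def sum.If_cases sum_distrib_left)
  also have "\<dots> = (\<Sum>i\<in>UNIV. \<Sum>j\<in>UNIV. if G i j then x $ j * y $ i else 0)"
    by (subst sum.swap) (simp add: simple_graph_sym[OF assms])
  also have "\<dots> = adj_op G x \<bullet> y"
    by (simp add: inner_vec_def adj_op_def sum.If_cases sum_distrib_right)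
  finally show ?thesis .
qed

lemma adj_matrix_mult_of_real:
  "adj_matrix G *v (\<chi> x. of_real (z $ x)) = (\<chi> x. of_real (adj_op G z $ x))"
  by (simp add: vec_eq_iff adj_matrix_def matrix_vector_mult_def adj_op_def if_distrib[of "\<lambda>c. c * _"]
      sum.If_cases cong: if_cong)

text \<open>The exponent \<open>B\<close> is symmetric with conjugate \<open>- B\<close>, so the
  conjugate transpose of \<open>matrix_exp B\<close> is its inverse
  \<open>matrix_exp (- B)\<close>.\<close>

lemma transition_matrix_mult_cnj:
  assumes "simple_graph G"
  shows "(\<Sum>x\<in>UNIV. transition_matrix G t $ x $ u * cnj (transition_matrix G t $ x $ u)) = 1"
proof -
  define B where "B = (\<chi> x y. - \<i> * of_real t * adj_matrix G $ x $ y)"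
  have U: "transition_matrix G t = matrix_exp B" by (simp add: transition_matrix_def B_def)
  have "transpose B = B"
    by (simp add: B_def transpose_def vec_eq_iff adj_matrix_def simple_graph_sym[OF assms])
  then have tr: "transpose (matrix_exp B) = matrix_exp B" by (simp add: transpose_matrix_exp)
  have "(\<chi> i j. cnj (B $ i $ j)) = - B"
    by (simp add: B_def vec_eq_iff adj_matrix_def)
  then have cj: "cnj (matrix_exp B $ i $ j) = matrix_exp (- B) $ i $ j" for i j
    by (simp add: cnj_matrix_exp)
  have sym: "matrix_exp B $ x $ u = matrix_exp B $ u $ x" for x
    using tr by (metis transpose_def vec_lambda_beta)
  have "(\<Sum>x\<in>UNIV. matrix_exp B $ x $ u * cnj (matrix_exp B $ x $ u)) =
      (matrix_exp B ** matrix_exp (- B)) $ u $ u"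
    by (simp only: cj matrix_matrix_mult_def vec_lambda_beta) (simp only: sym)
  then show ?thesis by (simp add: U matrix_exp_mult_uminus mat_def)
qed

text \<open>By symmetry of the adjacency matrix, a right eigenvector is also a left one.\<close>

lemma transition_matrix_eigenvector:
  assumes "simple_graph G" and "adj_op G z = \<mu> *\<^sub>R z"
  shows "(\<Sum>x\<in>UNIV. of_real (z $ x) * transition_matrix G t $ x $ y) =
    exp (- \<i> * of_real (t * \<mu>)) * of_real (z $ y)"
proof -
  define B where "B = (\<chi> x y. - \<i> * of_real t * adj_matrix G $ x $ y)"
  define Z :: "complex ^ 'a" where "Z = (\<chi> x. of_real (z $ x))"
  have "(Z v* B) $ y = (- \<i> * of_real (t * \<mu>)) * Z $ y" for y
  proof -
    have "(Z v* B) $ y = - \<i> * of_real t * (adj_matrix G *v Z) $ y"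
      by (simp add: vector_matrix_mult_def matrix_vector_mult_def B_def adj_matrix_def sum_distrib_left
          simple_graph_sym[OF assms(1), of _ y] mult_ac)
    then show ?thesis
      by (simp add: Z_def adj_matrix_mult_of_real assms(2))
  qed
  then have "Z v* B = (- \<i> * of_real (t * \<mu>)) *s Z" by (simp add: vec_eq_iff)
  from matrix_exp_left_eigenvector[OF this]
  have "(Z v* matrix_exp B) $ y = exp (- \<i> * of_real (t * \<mu>)) * Z $ y" by simp
  then show ?thesis
    by (simp add: vector_matrix_mult_def Z_def transition_matrix_def B_def mult.commute)
qed

text \<open>The common consequence of periodicity and of state transfer, so that a single argument
  excludes both.\<close>

definition support_phase :: "('v::finite \<Rightarrow> 'v \<Rightarrow> bool) \<Rightarrow> 'v \<Rightarrow> real \<Rightarrow> complex \<Rightarrow> bool" where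
  "support_phase G p s c \<longleftrightarrow>
    (\<forall>\<mu> z. adj_op G z = \<mu> *\<^sub>R z \<longrightarrow> z $ p \<noteq> 0 \<longrightarrow> exp (- \<i> * of_real (s * \<mu>)) = c)"

text \<open>Column \<open>p\<close> of the unitary matrix has norm 1, so a diagonal entry of modulus
  1 leaves no room for other nonzero entries; pairing the column with \<open>z\<close> isolates the
  phase.\<close>

lemma periodic_vertex_support_phase:
  assumes G: "simple_graph G" and "periodic_vertex G p"
  obtains s c where "s > 0" "support_phase G p s c"
proof -
  from assms(2) obtain t where t: "t > 0"
    "cmod ((transition_matrix G t *v axis p 1) $ p) = 1"
    by (auto simp: periodic_vertex_def)
  define U where "U = transition_matrix G t"
  have Upp: "cmod (U $ p $ p) = 1"
    using t(2) by (simp add: U_def matrix_vector_mult_axis_nth)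
  have "of_real (\<Sum>x\<in>UNIV. (cmod (U $ x $ p))\<^sup>2) = (1::complex)"
    using transition_matrix_mult_cnj[OF G, of t p]
    by (simp only: of_real_sum complex_norm_square U_def)
  then have "(\<Sum>x\<in>UNIV. (cmod (U $ x $ p))\<^sup>2) = 1"
    using of_real_eq_1_iff by blast
  then have "(\<Sum>x\<in>UNIV - {p}. (cmod (U $ x $ p))\<^sup>2) = 0"
    by (simp add: sum.remove[of UNIV p] Upp)
  then have off: "U $ x $ p = 0" if "x \<noteq> p" for x
    using that by (simp add: sum_nonneg_eq_0_iff)
  have "support_phase G p t (U $ p $ p)"
    unfolding support_phase_def
  proof (intro allI impI)
    fix \<mu> and z :: "real ^ 'a"
    assume z: "adj_op G z = \<mu> *\<^sub>R z" "z $ p \<noteq> 0"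
    have "(\<Sum>x\<in>UNIV. of_real (z $ x) * U $ x $ p) = of_real (z $ p) * U $ p $ p"
      by (simp add: sum.remove[of UNIV p] off)
    with transition_matrix_eigenvector[OF G z(1), of t p] z(2)
    show "exp (- \<i> * of_real (t * \<mu>)) = U $ p $ p" by (simp add: U_def)
  qed
  with t(1) that show thesis by blast
qed

text \<open>
  Real eigenvectors have \<open>z\<^sub>q = \<plusminus> z\<^sub>p\<close>, so the phase is determined only up to sign; doubling the time
  removes the sign.
\<close>

lemma perfect_state_transfer_support_phase:
  assumes G: "simple_graph G" and "perfect_state_transfer G p q"
  obtains s c where "s > 0" "support_phase G p s c"
proof -
  from assms(2) obtain t \<gamma> where t: "t > 0" and \<gamma>: "cmod \<gamma> = 1"
    and U: "transition_matrix G t *v axis p 1 = \<gamma> *s axis q 1"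
    by (auto simp: perfect_state_transfer_def)
  have col: "transition_matrix G t $ x $ p = (if x = q then \<gamma> else 0)" for x
    using arg_cong[OF U, of "\<lambda>v. v $ x"]
    by (auto simp: matrix_vector_mult_axis_nth) (auto simp: axis_def)
  have "support_phase G p (2 * t) (\<gamma>\<^sup>2)"
    unfolding support_phase_def
  proof (intro allI impI)
    fix \<mu> and z :: "real ^ 'a"
    assume z: "adj_op G z = \<mu> *\<^sub>R z" "z $ p \<noteq> 0"
    define E where "E = exp (- \<i> * of_real (t * \<mu>))"
    have E: "E * of_real (z $ p) = \<gamma> * of_real (z $ q)"
      using transition_matrix_eigenvector[OF G z(1), of t p]
      by (simp add: E_def col if_distrib[of "\<lambda>c. _ * c"] mult.commute cong: if_cong)
    have "cmod E = 1" by (simp add: E_def)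
    then have "\<bar>z $ p\<bar> = \<bar>z $ q\<bar>"
      using arg_cong[OF E, of cmod] \<gamma> by (simp add: norm_mult)
    then have "(z $ p)\<^sup>2 = (z $ q)\<^sup>2" by (simp add: power2_eq_iff abs_eq_iff)
    then have "(complex_of_real (z $ p))\<^sup>2 = (of_real (z $ q))\<^sup>2"
      by (metis of_real_power)
    then have "E\<^sup>2 * (of_real (z $ p))\<^sup>2 = \<gamma>\<^sup>2 * (of_real (z $ p))\<^sup>2"
      using arg_cong[OF E, of "\<lambda>c. c\<^sup>2"] by (simp add: power_mult_distrib)
    then have "E\<^sup>2 = \<gamma>\<^sup>2" using z(2) by simp
    moreover have "exp (- \<i> * of_real (2 * t * \<mu>)) = E\<^sup>2"
      unfolding E_def exp_double[symmetric] by (simp add: algebra_simps)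
    ultimately show "exp (- \<i> * of_real (2 * t * \<mu>)) = \<gamma>\<^sup>2" by simp
  qed
  with t that[of "2 * t"] show thesis by simp
qed

lemma support_phase_diff:
  assumes "support_phase G p s c"
    and "adj_op G z = \<mu> *\<^sub>R z" "z $ p \<noteq> 0" and "adj_op G z' = \<nu> *\<^sub>R z'" "z' $ p \<noteq> 0"
  obtains m :: int where "s * (\<mu> - \<nu>) = 2 * pi * of_int m"
proof -
  have "exp (- \<i> * of_real (s * \<nu>)) = exp (- \<i> * of_real (s * \<mu>))"
    using assms unfolding support_phase_def by metis
  then have "exp (- \<i> * of_real (s * \<nu>) - - \<i> * of_real (s * \<mu>)) = 1"
    by (simp only: exp_diff) simp
  then obtain m :: int where "s * \<mu> - s * \<nu> = of_int (2 * m) * pi"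
    unfolding exp_eq_1 by auto
  then show thesis using that[of m] by (simp add: algebra_simps)
qed

section \<open>The neighborhood corona\<close>

lemma regular_graph_sum: "regular_graph d G \<Longrightarrow> (\<Sum>y | G x y. c) = real d * c"
  by (simp add: regular_graph_def)

text \<open>
  On the span of \<open>u \<otimes> e\<^sub>0\<close> and \<open>u \<otimes> 1\<close> the corona acts by the matrix with rows \<open>(\<theta>, n\<^sub>2\<theta>)\<close> and
  \<open>(\<theta>, k)\<close>.
\<close>

lemma neighborhood_corona_eigenvector:
  fixes G :: "'a::finite \<Rightarrow> 'a \<Rightarrow> bool" and H :: "'b::finite \<Rightarrow> 'b \<Rightarrow> bool"
  assumes G: "simple_graph G" and H: "regular_graph k H"
    and u: "adj_op G u = \<theta> *\<^sub>R u"
    and \<mu>: "(\<mu> - \<theta>) * (\<mu> - real k) = real CARD('b) * \<theta>\<^sup>2"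
  defines "z \<equiv> \<chi> p. (case snd p of None \<Rightarrow> \<mu> - real k | Some _ \<Rightarrow> \<theta>) * u $ fst p"
  shows "adj_op (neighborhood_corona G H) z = \<mu> *\<^sub>R z"
proof -
  have split: "(\<Sum>q\<in>UNIV. f q) = (\<Sum>x\<in>UNIV. f (x, None) + (\<Sum>y\<in>UNIV. f (x, Some y)))"
    for f :: "'a \<times> 'b option \<Rightarrow> real"
    by (simp add: UNIV_option_conv sum.reindex sum.cartesian_product' flip: UNIV_Times_UNIV)
  have op: "adj_op K v $ p = (\<Sum>q\<in>UNIV. if K p q then v $ q else 0)"
    for K :: "'v::finite \<Rightarrow> 'v \<Rightarrow> bool" and v p
    by (simp add: adj_op_def sum.If_cases)
  have Gu: "(\<Sum>x'\<in>UNIV. if G x x' then u $ x' else 0) = \<theta> * u $ x" for x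
    using u by (simp flip: op)
  have Gu': "(\<Sum>x'\<in>UNIV. if G x x' then a * u $ x' else 0) = a * (\<theta> * u $ x)" for x a
    by (simp add: sum_distrib_left if_distrib cong: if_cong flip: Gu)
  have Hsum: "(\<Sum>y'\<in>UNIV. if H y y' then a else 0) = real k * a" for y a
    using regular_graph_sum[OF H, where c = a] by (simp add: sum.If_cases)
  have "adj_op (neighborhood_corona G H) z $ (x, w) = (\<mu> *\<^sub>R z) $ (x, w)" for x w
  proof (cases w)
    case None
    have "adj_op (neighborhood_corona G H) z $ (x, w) =
        (\<Sum>x'\<in>UNIV. if G x x' then (\<mu> - real k + real CARD('b) * \<theta>) * u $ x' else 0)"
      unfolding op split None
      by (intro sum.cong) (auto simp: z_def simple_graph_sym[OF G, of _ x] algebra_simps)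
    also have "\<dots> = ((\<mu> - real k) * \<theta> + real CARD('b) * \<theta>\<^sup>2) * u $ x"
      unfolding Gu' by (simp add: algebra_simps power2_eq_square)
    \<comment> \<open>This is the characteristic equation of the two-by-two matrix.\<close>
    also have "\<dots> = \<mu> * (\<mu> - real k) * u $ x"
      by (simp add: algebra_simps flip: \<mu>)
    finally show ?thesis by (simp add: None z_def)
  next
    case (Some y)
    have "adj_op (neighborhood_corona G H) z $ (x, w) =
        (\<Sum>x'\<in>UNIV. if G x x' then (\<mu> - real k) * u $ x' else 0) +
        (\<Sum>x'\<in>UNIV. if x = x' then (\<Sum>y'\<in>UNIV. if H y y' then \<theta> * u $ x' else 0) else 0)"
      unfolding op split Some sum.distrib
      by (intro arg_cong2[of _ _ _ _ "(+)"] sum.cong) (auto simp: z_def cong: if_cong)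
    also have "\<dots> = (\<mu> - real k) * (\<theta> * u $ x) + real k * (\<theta> * u $ x)"
      unfolding Gu' by (simp add: Hsum)
    finally show ?thesis by (simp add: Some z_def algebra_simps)
  qed
  then show ?thesis by (simp add: vec_eq_iff)
qed

lemma neighborhood_corona_no_support_phase:
  fixes G :: "'a::finite \<Rightarrow> 'a \<Rightarrow> bool" and H :: "'b::finite \<Rightarrow> 'b \<Rightarrow> bool"
  assumes G: "simple_graph G" "regular_graph r G" "integral_graph G" and H: "regular_graph k H"
    and D: "sqrt ((real r - real k)\<^sup>2 + 4 * real CARD('b) * (real r)\<^sup>2) \<notin> \<int>"
    and s: "s > 0"
  shows "\<not> support_phase (neighborhood_corona G H) (v, w) s c"
proof
  assume phase: "support_phase (neighborhood_corona G H) (v, w) s c"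
  \<comment> \<open>For \<open>r = 0\<close> the square root would be the integer
    \<open>k\<close>.\<close>
  have "r > 0"
    using D by (cases "r = 0") auto
  define d where "d \<theta> = sqrt ((\<theta> - real k)\<^sup>2 + 4 * real CARD('b) * \<theta>\<^sup>2)" for \<theta>
  \<comment> \<open>The sign \<open>\<sigma>\<close> selects one of the two roots belonging to
    \<open>\<theta>\<close>; \<open>d \<theta>\<close> is the gap between them.\<close>
  define \<mu> where "\<mu> \<sigma> \<theta> = (\<theta> + real k + \<sigma> * d \<theta>) / 2" for \<sigma> \<theta>
  have ev: "\<exists>z. adj_op (neighborhood_corona G H) z = \<mu> \<sigma> \<theta> *\<^sub>R z \<and> z $ (v, w) \<noteq> 0"
    if u: "adj_op G u = \<theta> *\<^sub>R u" "u $ v \<noteq> 0" "\<theta> \<noteq> 0" and \<sigma>: "\<sigma>\<^sup>2 = 1" for \<sigma> \<theta> u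
  proof -
    have "(\<sigma> * d \<theta>)\<^sup>2 = (\<theta> - real k)\<^sup>2 + 4 * real CARD('b) * \<theta>\<^sup>2"
      by (simp add: d_def \<sigma> power_mult_distrib)
    then have root: "(\<mu> \<sigma> \<theta> - \<theta>) * (\<mu> \<sigma> \<theta> - real k) = real CARD('b) * \<theta>\<^sup>2"
      by (simp add: \<mu>_def field_simps power2_eq_square)
    \<comment> \<open>This keeps the lifted eigenvector nonzero at \<open>(v, None)\<close>; at
      \<open>(v, Some y)\<close> its factor is \<open>\<theta>\<close> itself.\<close>
    then have "\<mu> \<sigma> \<theta> \<noteq> real k" using \<open>\<theta> \<noteq> 0\<close> by auto
    with neighborhood_corona_eigenvector[OF G(1) H u(1) root] u(2,3) show ?thesis
      by (intro exI conjI) (auto split: option.splits)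
  qed
  have diff: "\<exists>m::int. s * (\<mu> \<sigma> \<theta> - \<mu> \<sigma>' \<theta>') = 2 * pi * of_int m"
    if "adj_op G u = \<theta> *\<^sub>R u" "u $ v \<noteq> 0" "\<theta> \<noteq> 0" "\<sigma>\<^sup>2 = 1"
      and "adj_op G u' = \<theta>' *\<^sub>R u'" "u' $ v \<noteq> 0" "\<theta>' \<noteq> 0" "\<sigma>'\<^sup>2 = 1" for \<sigma> \<theta> u \<sigma>' \<theta>' u'
    using ev[OF that(1-4)] ev[OF that(5-8)] support_phase_diff[OF phase] by metis

  have one: "adj_op G 1 = real r *\<^sub>R 1"
    using regular_graph_sum[OF G(2), where c = 1] by (simp add: vec_eq_iff adj_op_def)
  have "axis v 1 \<bullet> adj_op G (axis v 1) = 0"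
    using G(1) unfolding inner_axis'
    by (simp add: adj_op_def axis_def simple_graph_def irreflp_def)
  \<comment> \<open>Pairing with the all-ones vector gives the degree \<open>r\<close>.\<close>
  moreover have "adj_op G (axis v 1) \<noteq> 0"
  proof -
    have "adj_op G (axis v 1) \<bullet> 1 = axis v 1 \<bullet> adj_op G 1"
      by (simp add: adj_op_self_adjoint[OF G(1)])
    also have "\<dots> = real r" by (simp add: one inner_axis')
    finally show ?thesis using \<open>r > 0\<close> by auto
  qed
  \<comment> \<open>Negativity secures both \<open>\<theta> \<noteq> 0\<close>, needed for lifting,
    and \<open>real r - \<theta> > 0\<close>, needed as a divisor.\<close>
  ultimately obtain \<theta> u where \<theta>: "\<theta> < 0" and u: "adj_op G u = \<theta> *\<^sub>R u" "u \<bullet> axis v 1 \<noteq> 0"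
    using self_adjoint_negative_eigenvalue[OF linear_adj_op adj_op_self_adjoint[OF G(1)]] by metis
  then have uv: "u $ v \<noteq> 0" by (simp add: inner_axis)
  have "eigenvalue (adj_matrix G) (of_real \<theta>)"
    unfolding eigenvalue_def
    by (rule exI[of _ "\<chi> x. of_real (u $ x)"])
      (use uv in \<open>auto simp: adj_matrix_mult_of_real u(1) vec_eq_iff\<close>)
  then have "complex_of_real \<theta> \<in> \<int>" using G(3) by (auto simp: integral_graph_def)
  then obtain a :: int where a: "\<theta> = of_int a"
    by (metis Ints_cases of_real_eq_iff of_real_of_int_eq)

  have r: "real r \<noteq> 0" using \<open>r > 0\<close> by simp
  obtain m1 m2 m3 :: int where
    m1: "s * (\<mu> 1 (real r) - \<mu> (- 1) (real r)) = 2 * pi * of_int m1" and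
    m2: "s * (\<mu> 1 (real r) - \<mu> 1 \<theta>) = 2 * pi * of_int m2" and
    m3: "s * (\<mu> (- 1) (real r) - \<mu> (- 1) \<theta>) = 2 * pi * of_int m3"
    using diff[OF one _ r _ one _ r, of 1 "- 1"] diff[OF one _ r _ u(1) uv, of 1 1]
      diff[OF one _ r _ u(1) uv, of "- 1" "- 1"] \<theta> by auto
  have "s * d (real r) = 2 * pi * of_int m1"
    using m1 by (simp add: \<mu>_def field_simps)
  \<comment> \<open>Adding the differences for both signs cancels the square roots over
    \<open>r\<close> and over \<open>\<theta>\<close>.\<close>
  moreover have sum: "s * (real r - \<theta>) = 2 * pi * of_int (m2 + m3)"
    using m2 m3 by (simp add: \<mu>_def field_simps)
  \<comment> \<open>Cross-multiplication eliminates the unknown time \<open>s\<close> together with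
    \<open>2 * pi\<close>.\<close>
  ultimately have "s * d (real r) * (2 * pi * of_int (m2 + m3)) =
      s * (real r - \<theta>) * (2 * pi * of_int m1)" by simp
  then have "d (real r) * of_int (m2 + m3) = (real r - \<theta>) * of_int m1"
    using s by simp
  moreover have "m2 + m3 \<noteq> 0"
    using sum s \<theta> \<open>r > 0\<close> by (auto simp del: of_int_add)
  ultimately have "d (real r) = of_int ((int r - a) * m1) / of_int (m2 + m3)"
    by (simp add: a field_simps)
  then have "d (real r) \<in> \<rat>" by simp
  \<comment> \<open>As the square root of an integer, \<open>d (real r)\<close> is an algebraic
    integer, and a rational one is an integer.\<close>
  moreover have "algebraic_int (d (real r))"
    unfolding d_def by (intro algebraic_int_sqrt int_imp_algebraic_int) auto
  ultimately have "d (real r) \<in> \<int>" by (rule rational_algebraic_int_is_int[rotated])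
  with D show False by (simp add: d_def)
qed

theorem theorem4p4:
  fixes G1 :: "'a::finite \<Rightarrow> 'a \<Rightarrow> bool"
    and G2 :: "'b::finite \<Rightarrow> 'b \<Rightarrow> bool"
    and r k n1 n2 :: nat
  assumes "simple_graph G1" and "regular_graph r G1" and "connected_graph G1"
    and "integral_graph G1" and "n1 = CARD('a)"
    and "simple_graph G2" and "regular_graph k G2" and "n2 = CARD('b)"
    and "sqrt ((real r - real k)\<^sup>2 + 4 * real n2 * (real r)\<^sup>2) \<notin> \<int>"
  shows "(\<forall>v w. \<not> periodic_vertex (neighborhood_corona G1 G2) (v, w)) \<and>
    (\<forall>x y. \<not> perfect_state_transfer (neighborhood_corona G1 G2) x y)"
proof -
  let ?C = "neighborhood_corona G1 G2"
  have C: "simple_graph ?C"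
    by (rule simple_graph_neighborhood_corona) fact+
  have no_phase: "\<not> support_phase ?C p s c" if "s > 0" for p s c
    using neighborhood_corona_no_support_phase[OF assms(1,2,4,7) _ that] assms(8,9)
    by (cases p) simp
  show ?thesis
    using no_phase periodic_vertex_support_phase[OF C] perfect_state_transfer_support_phase[OF C]
    by metis
qed

end
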